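(* For every positive even integer $n$ not divisible by $3$ there is a handle $H$ such that the Collatz Series starting from $H$ reaches $n$ after fewer than $7$ steps, where one step is either one "up" operation or one "down" operation.
   Context: The Collatz Series starting from a positive integer is the sequence generated by recursively applying the Collatz rules: the "up" operation $m\mapsto 3m+1$ if $m$ is odd, and the "down" operation $m\mapsto m/2$ if $m$ is even. A handle is a positive odd integer divisible by $3$. *)

theory Defs
  imports Main
begin

definition collatz_step :: "nat \<Rightarrow> nat" where
  "collatz_step m = (if odd m then 3 * m + 1 else m div 2)"

text \<open>The series starts with its initial value at index 0, so that index \<open>k\<close> is the value
  reached after exactly \<open>k\<close> up or down steps. The series does not stop on reaching 1.\<close>

definition collatz_series :: "nat \<Rightarrow> nat \<Rightarrow> nat" where
  "collatz_series m k = (collatz_step ^^ k) m"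

definition handle :: "nat \<Rightarrow> bool" where
  "handle h \<longleftrightarrow> h > 0 \<and> odd h \<and> 3 dvd h"

end

(* The powers 2^0, ..., 2^5 represent every unit modulo 9, so some n * 2^j with j < 6 is an even
   number congruent to 1 modulo 9, that is, of the form 3 * H + 1 with H a handle. *)
theory Submission
  imports Defs
begin

text \<open>Build the path backwards from \<open>n\<close>: double it \<open>j\<close> times, then
  undo one up step. The result \<open>(2 ^ j * n - 1) div 3\<close> is an exact quotient divisible
  by 3 precisely when \<open>2 ^ j * n\<close> is 1 modulo 9;
  \<open>ex_power_of_two_mult_mod_9\<close> supplies such a \<open>j\<close>.\<close>

lemma collatz_series_power_of_two_mult: "collatz_series (2 ^ j * n) j = n"
proof (induction j)
  case 0
  show ?case by (simp add: collatz_series_def)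
next
  case (Suc j)
  have "collatz_step (2 ^ Suc j * n) = 2 ^ j * n"
    by (simp add: collatz_step_def)
  with Suc show ?case
    by (simp add: collatz_series_def funpow_Suc_right del: funpow.simps)
qed

text \<open>2 is a primitive root modulo 9, so the inverse of the unit \<open>n\<close> is among its
  first six powers.\<close>

lemma ex_power_of_two_mult_mod_9:
  fixes n :: nat
  assumes "\<not> 3 dvd n"
  shows "\<exists>j<6. 2 ^ j * n mod 9 = 1"
proof -
  have "n mod 9 \<in> {1, 2, 4, 5, 7, 8}"
    using assms by (simp, presburger)
  then have "\<exists>j\<in>{0, 1, 2, 3, 4, 5}. 2 ^ j * (n mod 9) mod 9 = 1"
    by auto
  then show ?thesis
    unfolding mod_mult_right_eq by force
qed

theorem proposition5p2:
  fixes n :: nat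
  assumes "n > 0" and "even n" and "\<not> 3 dvd n"
  shows "\<exists>H. handle H \<and> (\<exists>k<7. collatz_series H k = n)"
proof -
  obtain j where j: "j < 6" "2 ^ j * n mod 9 = 1"
    using ex_power_of_two_mult_mod_9[OF assms(3)] by blast
  define H where "H = (2 ^ j * n - 1) div 3"
  have "even (2 ^ j * n)"
    using assms(2) by simp
  \<comment> \<open>Evenness of \<open>2 ^ j * n\<close> makes \<open>H\<close> odd and rules out
    \<open>2 ^ j * n = 1\<close>, that is, \<open>H = 0\<close>.\<close>
  then have H: "3 * H + 1 = 2 ^ j * n" and "handle H"
    using j(2) unfolding H_def handle_def by presburger+
  have "collatz_step H = 2 ^ j * n"
    using \<open>handle H\<close> H by (simp add: collatz_step_def handle_def)
  \<comment> \<open>One up step, then \<open>j\<close> halvings.\<close>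
  then have "collatz_series H (Suc j) = n"
    using collatz_series_power_of_two_mult[of j n]
    by (simp add: collatz_series_def funpow_Suc_right del: funpow.simps)
  moreover have "Suc j < 7"
    using j(1) by simp
  ultimately show ?thesis
    using \<open>handle H\<close> by blast
qed

end
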